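(* Let $V^{\mathrm{Rel}}$ be the value function of a relaxation of the unit commitment problem, so that $V^{\mathrm{Rel}}(D')\le V(D')$ for all $D'\in\mathbb{R}^{|\mathcal{I}|}$. Let $(x^{\mathrm{Feas}},r^{\mathrm{Feas}})$ be a feasible solution of the unit commitment problem at $D$, with total cost $z^{\mathrm{Feas}}(D)=\sum_{g\in\mathcal{G}}C_g(x_g^{\mathrm{Feas}})$, and let $U_g(\pi)$ be the lost opportunity cost of generator $g$ relative to this solution. If $\pi\in\partial V^{\mathrm{Rel}}(D)$, then $$\sum_{g\in\mathcal{G}}U_g(\pi)\le z^{\mathrm{Feas}}(D)-V^{\mathrm{Rel}}(D).$$
   Context: General unit commitment problem parameterized by a demand vector $D\in\mathbb{R}^{|\mathcal{I}|}$, where the finite set $\mathcal{I}$ indexes demand at all buses in $\mathcal{N}$ and all time periods in $\mathcal{T}$ (and real/reactive components in the alternating-current case). $\mathcal{G}$ is a finite set of generators; generator $g$ is located at bus $k(g)$, has a decision vector $x_g\in\mathcal{X}_g$ (binary commitment and continuous production variables) and a real-valued cost function $C_g(x_g)$; its vector of production levels $s_g$ is a subvector of $x_g$ (and $s_g^{\mathrm{Feas}}$ that of $x_g^{\mathrm{Feas}}$), and $s=(s_g)_{g\in\mathcal{G}}$. $\mathcal{R}\subseteq\mathbb{R}^{|\mathcal{I}|}$ is the set of network-feasible net outflow vectors $r$. The value function is $$V(D):=\min\Big\{\sum_{g\in\mathcal{G}}C_g(x_g):\ x_g\in\mathcal{X}_g\ \forall g\in\mathcal{G},\ r\in\mathcal{R},\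 A^ss-r=D\Big\},$$ with $V(D)=+\infty$ if infeasible. The matrix $A^s$ aggregates production by bus, so that $\pi^\top A^ss=\sum_{g\in\mathcal{G}}\pi_{k(g)}^\top s_g$ for every $\pi\in\mathbb{R}^{|\mathcal{I}|}$, where $\pi_{k(g)}$ is the subvector of $\pi$ of prices at bus $k(g)$. Lost opportunity cost of $g$ at price vector $\pi$: $$U_g(\pi):=\max_{x_g\in\mathcal{X}_g}\big(\pi_{k(g)}^\top s_g-C_g(x_g)\big)-\big(\pi_{k(g)}^\top s_g^{\mathrm{Feas}}-C_g(x_g^{\mathrm{Feas}})\big),$$ where the maximum is assumed to be attained. $\partial V^{\mathrm{Rel}}(D)$ is the convex subdifferential: $\pi\in\partial V^{\mathrm{Rel}}(D)$ iff $V^{\mathrm{Rel}}(D)$ is finite and $V^{\mathrm{Rel}}(D')\ge V^{\mathrm{Rel}}(D)+\pi^\top(D'-D)$ for all $D'\in\mathbb{R}^{|\mathcal{I}|}$. *)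

theory Defs
  imports "HOL-Analysis.Analysis"
begin

text \<open>
  Buses, time periods and power components are finite index types \<open>'n\<close>, \<open>'t\<close>, \<open>'c\<close>; the demand
  index set is their product. The type \<open>'c\<close> has one element for real power only (direct current)
  and two for real and reactive power (alternating current).
\<close>

type_synonym ('n, 't, 'c) demand = "real ^ ('n \<times> 't \<times> 'c)"

text \<open>
  The decision vectors of different generators may have different lengths, so the decision vector
  of \<open>g\<close> is a function supported (in the sense of \<^const>\<open>extensional\<close>) on a finite set \<open>vars g\<close> of
  coordinates. The coordinates in \<open>commit g\<close> are binary; \<open>prod_var g (t, c)\<close> is the coordinate
  holding the production of component \<open>c\<close> in period \<open>t\<close>.
\<close>

record ('g, 'n, 't, 'c, 'v) unit_commitment =
  location :: "'g \<Rightarrow> 'n"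
  vars :: "'g \<Rightarrow> 'v set"
  commit :: "'g \<Rightarrow> 'v set"
  prod_var :: "'g \<Rightarrow> 't \<times> 'c \<Rightarrow> 'v"
  decisions :: "'g \<Rightarrow> ('v \<Rightarrow> real) set"
  cost :: "'g \<Rightarrow> ('v \<Rightarrow> real) \<Rightarrow> real"
  outflows :: "('n, 't, 'c) demand set"

definition valid_uc ::
    "('g::finite, 'n::finite, 't::finite, 'c::finite, 'v) unit_commitment \<Rightarrow> bool" where
  "valid_uc P \<longleftrightarrow>
    (\<forall>g. finite (vars P g) \<and>
         commit P g \<subseteq> vars P g \<and>
         inj (prod_var P g) \<and>
         range (prod_var P g) \<subseteq> vars P g - commit P g \<and>
         decisions P g \<subseteq>
           {x \<in> vars P g \<rightarrow>\<^sub>E UNIV. \<forall>j\<in>commit P g. x j \<in> {0, 1}})"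

definition production ::
    "('g::finite, 'n::finite, 't::finite, 'c::finite, 'v) unit_commitment \<Rightarrow> 'g \<Rightarrow> ('v \<Rightarrow> real)
      \<Rightarrow> real ^ ('t \<times> 'c)" where
  "production P g xg = (\<chi> j. xg (prod_var P g j))"

definition productions ::
    "('g::finite, 'n::finite, 't::finite, 'c::finite, 'v) unit_commitment \<Rightarrow> ('g \<Rightarrow> 'v \<Rightarrow> real)
      \<Rightarrow> real ^ ('g \<times> 't \<times> 'c)" where
  "productions P x = (\<chi> q. production P (fst q) (x (fst q)) $ snd q)"

definition at_bus ::
    "('n::finite, 't::finite, 'c::finite) demand \<Rightarrow> 'n \<Rightarrow> real ^ ('t \<times> 'c)" where
  "at_bus d k = (\<chi> j. d $ (k, j))"

definition aggregation ::
    "('g::finite, 'n::finite, 't::finite, 'c::finite, 'v) unit_commitment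
      \<Rightarrow> real ^ ('g \<times> 't \<times> 'c) ^ ('n \<times> 't \<times> 'c)" where
  "aggregation P = (\<chi> p q. if location P (fst q) = fst p \<and> snd q = snd p then 1 else 0)"

lemma inner_aggregation:
  fixes P :: "('g::finite, 'n::finite, 't::finite, 'c::finite, 'v) unit_commitment"
  shows "d \<bullet> (aggregation P *v productions P x) =
    (\<Sum>g\<in>UNIV. at_bus d (location P g) \<bullet> production P g (x g))"
proof -
  have row: "(aggregation P *v productions P x) $ (k, i) =
      (\<Sum>g\<in>UNIV. if location P g = k then production P g (x g) $ i else 0)" for k i
  proof -
    have "(aggregation P *v productions P x) $ (k, i) =
        (\<Sum>(g, j)\<in>UNIV \<times> UNIV.
          (if location P g = k \<and> j = i then 1 else 0) * production P g (x g) $ j)"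
      unfolding matrix_vector_mult_def aggregation_def productions_def
      by (auto intro!: sum.cong)
    also have "\<dots> = (\<Sum>g\<in>UNIV. \<Sum>j\<in>UNIV.
          if j = i then (if location P g = k then production P g (x g) $ j else 0) else 0)"
      unfolding sum.cartesian_product[symmetric] by (intro sum.cong refl) auto
    finally show ?thesis by simp
  qed
  have "d \<bullet> (aggregation P *v productions P x) =
      (\<Sum>(k, i)\<in>UNIV \<times> UNIV. d $ (k, i) * (aggregation P *v productions P x) $ (k, i))"
    by (auto simp: inner_vec_def intro!: sum.cong)
  also have "\<dots> = (\<Sum>k\<in>UNIV. \<Sum>i\<in>UNIV. \<Sum>g\<in>UNIV.
      if location P g = k then d $ (k, i) * production P g (x g) $ i else 0)"
    unfolding sum.cartesian_product[symmetric]
    by (auto simp: row sum_distrib_left intro!: sum.cong)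
  also have "\<dots> = (\<Sum>k\<in>UNIV. \<Sum>g\<in>UNIV. \<Sum>i\<in>UNIV.
      if location P g = k then d $ (k, i) * production P g (x g) $ i else 0)"
    by (intro sum.cong refl sum.swap)
  also have "\<dots> = (\<Sum>g\<in>UNIV. \<Sum>k\<in>UNIV. \<Sum>i\<in>UNIV.
      if location P g = k then d $ (k, i) * production P g (x g) $ i else 0)"
    by (rule sum.swap)
  also have "\<dots> = (\<Sum>g\<in>UNIV. \<Sum>i\<in>UNIV. \<Sum>k\<in>UNIV.
      if location P g = k then d $ (k, i) * production P g (x g) $ i else 0)"
    by (intro sum.cong refl sum.swap)
  also have "\<dots> = (\<Sum>g\<in>UNIV. at_bus d (location P g) \<bullet> production P g (x g))"
    by (simp add: inner_vec_def at_bus_def)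
  finally show ?thesis .
qed

definition feasible ::
    "('g::finite, 'n::finite, 't::finite, 'c::finite, 'v) unit_commitment
      \<Rightarrow> ('n, 't, 'c) demand \<Rightarrow> ('g \<Rightarrow> 'v \<Rightarrow> real) \<Rightarrow> ('n, 't, 'c) demand \<Rightarrow> bool" where
  "feasible P D x r \<longleftrightarrow>
    (\<forall>g. x g \<in> decisions P g) \<and> r \<in> outflows P \<and> aggregation P *v productions P x - r = D"

definition total_cost ::
    "('g::finite, 'n::finite, 't::finite, 'c::finite, 'v) unit_commitment
      \<Rightarrow> ('g \<Rightarrow> 'v \<Rightarrow> real) \<Rightarrow> real" where
  "total_cost P x = (\<Sum>g\<in>UNIV. cost P g (x g))"

text \<open>
  The infimum in the extended reals is the minimum whenever the latter exists, and is \<open>\<infinity>\<close> if the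
  problem is infeasible.
\<close>

definition uc_value ::
    "('g::finite, 'n::finite, 't::finite, 'c::finite, 'v) unit_commitment
      \<Rightarrow> ('n, 't, 'c) demand \<Rightarrow> ereal" where
  "uc_value P D = Inf {ereal (total_cost P x) | x r. feasible P D x r}"

definition profit ::
    "('g::finite, 'n::finite, 't::finite, 'c::finite, 'v) unit_commitment
      \<Rightarrow> ('n, 't, 'c) demand \<Rightarrow> 'g \<Rightarrow> ('v \<Rightarrow> real) \<Rightarrow> real" where
  "profit P \<pi> g xg = at_bus \<pi> (location P g) \<bullet> production P g xg - cost P g xg"

definition profit_max_attained ::
    "('g::finite, 'n::finite, 't::finite, 'c::finite, 'v) unit_commitment
      \<Rightarrow> ('n, 't, 'c) demand \<Rightarrow> 'g \<Rightarrow> bool" where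
  "profit_max_attained P \<pi> g \<longleftrightarrow>
    (\<exists>xg\<in>decisions P g. \<forall>yg\<in>decisions P g. profit P \<pi> g yg \<le> profit P \<pi> g xg)"

text \<open>
  The supremum of reals below is the intended maximum only under \<^const>\<open>profit_max_attained\<close>;
  without an upper bound it is an unspecified value.
\<close>

definition lost_opportunity_cost ::
    "('g::finite, 'n::finite, 't::finite, 'c::finite, 'v) unit_commitment
      \<Rightarrow> ('g \<Rightarrow> 'v \<Rightarrow> real) \<Rightarrow> ('n, 't, 'c) demand \<Rightarrow> 'g \<Rightarrow> real" where
  "lost_opportunity_cost P x_feas \<pi> g =
    (SUP xg\<in>decisions P g. profit P \<pi> g xg) - profit P \<pi> g (x_feas g)"

definition subdifferential :: "('a::real_inner \<Rightarrow> ereal) \<Rightarrow> 'a \<Rightarrow> 'a set" where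
  "subdifferential f a =
    {p. \<bar>f a\<bar> \<noteq> \<infinity> \<and> (\<forall>b. f b \<ge> f a + ereal (p \<bullet> (b - a)))}"

end

theory Submission
  imports Defs
begin

text \<open>
  Let every generator switch to a decision \<open>y g\<close> that maximizes its profit at the prices \<open>\<pi>\<close>, while
  the network outflow stays at \<open>r_feas\<close>. Demand couples the generators, so \<open>y\<close> is in general
  infeasible at \<open>D\<close>; but it is feasible at the demand \<open>D'\<close> that it happens to serve. Since \<open>V_rel\<close>
  is a lower bound on the value function everywhere, the cost of \<open>y\<close> is at least \<open>V_rel D'\<close>, which
  the subgradient inequality bounds below by \<open>V_rel D + \<pi> \<bullet> (D' - D)\<close>. As the outflow has not moved,
  \<open>D' - D\<close> is the change in aggregate production alone, so \<open>\<pi> \<bullet> (D' - D)\<close> is the change in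
  the generators' total revenue. Rearranged, the total profit gained by switching from \<open>x_feas\<close> to
  \<open>y\<close> is at most the cost of \<open>x_feas\<close> minus \<open>V_rel D\<close> (\<open>subgradient_bounds_profit_gain\<close>), and that
  gain is the sum of the lost opportunity costs.
\<close>

lemma uc_value_le_total_cost:
  assumes "feasible P D x r"
  shows "uc_value P D \<le> ereal (total_cost P x)"
  unfolding uc_value_def using assms by (intro Inf_lower) auto

lemma sum_profit:
  "(\<Sum>g\<in>UNIV. profit P \<pi> g (x g)) =
    \<pi> \<bullet> (aggregation P *v productions P x) - total_cost P x"
  by (simp add: profit_def total_cost_def inner_aggregation sum_subtractf)

lemma lost_opportunity_cost_maximizer:
  assumes "y \<in> decisions P g"
    and "\<And>xg. xg \<in> decisions P g \<Longrightarrow> profit P \<pi> g xg \<le> profit P \<pi> g y"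
  shows "lost_opportunity_cost P x \<pi> g = profit P \<pi> g y - profit P \<pi> g (x g)"
proof -
  have "(SUP xg\<in>decisions P g. profit P \<pi> g xg) = profit P \<pi> g y"
    using assms by (intro cSup_eq_maximum) auto
  then show ?thesis by (simp add: lost_opportunity_cost_def)
qed

text \<open>
  Keeping the outflow \<open>r\<close> of the feasible solution makes \<open>y\<close> feasible at some demand, and both the
  lower bound and the subgradient inequality hold at every demand. The cost of \<open>y\<close> enters both its
  profit and the upper bound on \<open>V\<close> at that demand, and cancels.
\<close>

lemma subgradient_bounds_profit_gain:
  fixes P :: "('g::finite, 'n::finite, 't::finite, 'c::finite, 'v) unit_commitment"
    and V :: "('n, 't, 'c) demand \<Rightarrow> ereal"
  assumes lower: "\<And>D'. V D' \<le> uc_value P D'"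
    and feas: "feasible P D x r"
    and sub: "\<pi> \<in> subdifferential V D"
    and y: "\<And>g. y g \<in> decisions P g"
  shows "ereal (\<Sum>g\<in>UNIV. profit P \<pi> g (y g) - profit P \<pi> g (x g))
    \<le> ereal (total_cost P x) - V D"
proof -
  define D' where "D' = aggregation P *v productions P y - r"
  have "feasible P D' y r"
    using feas y by (simp add: feasible_def D'_def)
  then have "V D' \<le> ereal (total_cost P y)"
    using lower uc_value_le_total_cost order_trans by blast
  moreover have "V D + ereal (\<pi> \<bullet> (D' - D)) \<le> V D'"
    using sub by (simp add: subdifferential_def)
  ultimately have bound: "V D + ereal (\<pi> \<bullet> (D' - D)) \<le> ereal (total_cost P y)"
    by (rule order_trans[rotated])
  obtain v where v: "V D = ereal v"
    using sub by (cases "V D") (auto simp: subdifferential_def)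
  have "D' - D = aggregation P *v productions P y - aggregation P *v productions P x"
    using feas by (auto simp: feasible_def D'_def)
  then have "(\<Sum>g\<in>UNIV. profit P \<pi> g (y g) - profit P \<pi> g (x g)) =
      \<pi> \<bullet> (D' - D) - total_cost P y + total_cost P x"
    by (simp add: sum_subtractf sum_profit inner_diff_right)
  then show ?thesis
    using bound v by simp
qed

theorem theorem2:
  fixes P :: "('g::finite, 'n::finite, 't::finite, 'c::finite, 'v) unit_commitment"
    and V_rel :: "('n, 't, 'c) demand \<Rightarrow> ereal"
    and D \<pi> r_feas :: "('n, 't, 'c) demand"
    and x_feas :: "'g \<Rightarrow> 'v \<Rightarrow> real"
  assumes "valid_uc P"
    and "\<And>D'. V_rel D' \<le> uc_value P D'"
    and "feasible P D x_feas r_feas"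
    and "\<And>g. profit_max_attained P \<pi> g"
    and "\<pi> \<in> subdifferential V_rel D"
  shows "ereal (\<Sum>g\<in>UNIV. lost_opportunity_cost P x_feas \<pi> g)
    \<le> ereal (total_cost P x_feas) - V_rel D"
proof -
  obtain y where y: "\<And>g. y g \<in> decisions P g"
    and max: "\<And>g xg. xg \<in> decisions P g \<Longrightarrow> profit P \<pi> g xg \<le> profit P \<pi> g (y g)"
    using assms(4) unfolding profit_max_attained_def by metis
  have "lost_opportunity_cost P x_feas \<pi> g =
      profit P \<pi> g (y g) - profit P \<pi> g (x_feas g)" for g
    using y max by (rule lost_opportunity_cost_maximizer)
  then show ?thesis
    using subgradient_bounds_profit_gain[where P = P, OF assms(2,3,5) y] by simp
qed

end
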